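(* Let $\mathcal{A},\mathcal{B}\in\mathbb{C}^{I_1\times\cdots\times I_N\times I_1\times\cdots\times I_N}$, and let $\mathcal{M},\mathcal{N}\in\mathbb{C}^{I_1\times\cdots\times I_N\times I_1\times\cdots\times I_N}$ be Hermitian positive definite tensors. Suppose $\mathcal{N}*_N\mathcal{B}^{\dagger}_{\mathcal{M}\mathcal{N}}=(\mathcal{N}*_N\mathcal{B})^H$. If $$\mathcal{A}*_N(\mathcal{B}*_N\mathcal{B}^{\dagger}_{\mathcal{M}\mathcal{N}})=(\mathcal{B}*_N\mathcal{B}^{\dagger}_{\mathcal{M}\mathcal{N}})*_N\mathcal{A},$$ $$\mathcal{A}^{\dagger}_{\mathcal{M}\mathcal{N}}*_N(\mathcal{B}*_N\mathcal{B}^{\dagger}_{\mathcal{M}\mathcal{N}})=(\mathcal{B}*_N\mathcal{B}^{\dagger}_{\mathcal{M}\mathcal{N}})*_N\mathcal{A}^{\dagger}_{\mathcal{M}\mathcal{N}},$$ then $(\mathcal{A}*_N\mathcal{B})^{\dagger}_{\mathcal{M}\mathcal{N}}=\mathcal{B}^{\dagger}_{\mathcal{M}\mathcal{N}}*_N\mathcal{A}^{\dagger}_{\mathcal{M}\mathcal{N}}$.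
   Context: For tensors $\mathcal{A},\mathcal{B}\in\mathbb{C}^{I_1\times\cdots\times I_N\times I_1\times\cdots\times I_N}$ the Einstein product is $(\mathcal{A}*_N\mathcal{B})_{i_1\cdots i_Nk_1\cdots k_N}=\sum_{j_1,\dots,j_N}a_{i_1\cdots i_Nj_1\cdots j_N}b_{j_1\cdots j_Nk_1\cdots k_N}$. The conjugate transpose is $(\mathcal{A}^H)_{j_1\cdots j_Ni_1\cdots i_N}=\overline{a_{i_1\cdots i_Nj_1\cdots j_N}}$. The identity tensor $\mathcal{I}$ has entries $\prod_{k}\delta_{i_kj_k}$; $\mathcal{U}$ is unitary if $\mathcal{U}*_N\mathcal{U}^H=\mathcal{U}^H*_N\mathcal{U}=\mathcal{I}$; $\mathcal{D}$ is diagonal if $d_{i_1\cdots i_Nj_1\cdots j_N}=0$ whenever $(i_1,\dots,i_N)\ne(j_1,\dots,j_N)$. A tensor $\mathcal{P}$ is Hermitian positive definite if $\mathcal{P}=\mathcal{U}*_N\mathcal{D}*_N\mathcal{U}^H$ with $\mathcal{U}$ unitary and $\mathcal{D}$ diagonal with positive diagonal entries. For Hermitian positive definite $\mathcal{M},\mathcal{N}$, the weighted Moore--Penrose inverse $\mathcal{A}^{\dagger}_{\mathcal{M}\mathcal{N}}$ is the unique tensor $\mathcal{X}\in\mathbb{C}^{I_1\times\cdots\times I_N\times I_1\times\cdots\times I_N}$ satisfying $\mathcal{A}*_N\mathcal{X}*_N\mathcal{A}=\mathcal{A}$, $\mathcal{X}*_N\mathcal{A}*_N\mathcal{X}=\mathcal{X}$,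 $(\mathcal{M}*_N\mathcal{A}*_N\mathcal{X})^H=\mathcal{M}*_N\mathcal{A}*_N\mathcal{X}$, $(\mathcal{N}*_N\mathcal{X}*_N\mathcal{A})^H=\mathcal{N}*_N\mathcal{X}*_N\mathcal{A}$. *)

theory Defs
  imports Complex_Main "HOL-Library.FuncSet"
begin

text \<open>A list \<open>I\<close> of length \<open>N\<close> holds the mode sizes \<open>I\<^sub>1, \<dots>, I\<^sub>N\<close>. The \<open>2N\<close> indices of an entry
  \<open>a\<close> are grouped as a pair of multi-indices, each of length \<open>N\<close>. Tensors are
  extensional functions, so that equality of tensors is equality of all entries.\<close>

type_synonym tensor = "nat list \<times> nat list \<Rightarrow> complex"

definition multi_indices :: "nat list \<Rightarrow> nat list set" where
  "multi_indices I = {i. length i = length I \<and> (\<forall>k < length I. i ! k \<in> {1..I ! k})}"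

definition tensors :: "nat list \<Rightarrow> tensor set" where
  "tensors I = (multi_indices I \<times> multi_indices I) \<rightarrow>\<^sub>E UNIV"

definition einstein_prod :: "tensor \<Rightarrow> nat list \<Rightarrow> tensor \<Rightarrow> tensor"
    ("(_ \<star>\<^bsub>_\<^esub>/ _)" [70, 0, 71] 70) where
  "A \<star>\<^bsub>I\<^esub> B = (\<lambda>(i, k) \<in> multi_indices I \<times> multi_indices I.
     \<Sum>j \<in> multi_indices I. A (i, j) * B (j, k))"

definition conj_transpose :: "nat list \<Rightarrow> tensor \<Rightarrow> tensor" where
  "conj_transpose I A = (\<lambda>(j, i) \<in> multi_indices I \<times> multi_indices I. cnj (A (i, j)))"

definition identity_tensor :: "nat list \<Rightarrow> tensor" where
  "identity_tensor I = (\<lambda>(i, j) \<in> multi_indices I \<times> multi_indices I.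
     \<Prod>k < length I. if i ! k = j ! k then 1 else 0)"

definition unitary_tensor :: "nat list \<Rightarrow> tensor \<Rightarrow> bool" where
  "unitary_tensor I U \<longleftrightarrow> U \<in> tensors I \<and>
     U \<star>\<^bsub>I\<^esub> conj_transpose I U = identity_tensor I \<and>
     conj_transpose I U \<star>\<^bsub>I\<^esub> U = identity_tensor I"

definition diagonal_tensor :: "nat list \<Rightarrow> tensor \<Rightarrow> bool" where
  "diagonal_tensor I D \<longleftrightarrow> D \<in> tensors I \<and>
     (\<forall>i \<in> multi_indices I. \<forall>j \<in> multi_indices I. i \<noteq> j \<longrightarrow> D (i, j) = 0)"

definition hermitian_pos_def :: "nat list \<Rightarrow> tensor \<Rightarrow> bool" where
  "hermitian_pos_def I P \<longleftrightarrow> P \<in> tensors I \<and>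
     (\<exists>U D. unitary_tensor I U \<and> diagonal_tensor I D \<and>
        (\<forall>i \<in> multi_indices I. D (i, i) \<in> \<real> \<and> Re (D (i, i)) > 0) \<and>
        P = U \<star>\<^bsub>I\<^esub> D \<star>\<^bsub>I\<^esub> conj_transpose I U)"

definition is_weighted_mp_inverse ::
    "nat list \<Rightarrow> tensor \<Rightarrow> tensor \<Rightarrow> tensor \<Rightarrow> tensor \<Rightarrow> bool" where
  "is_weighted_mp_inverse I M N A X \<longleftrightarrow> X \<in> tensors I \<and>
     A \<star>\<^bsub>I\<^esub> X \<star>\<^bsub>I\<^esub> A = A \<and>
     X \<star>\<^bsub>I\<^esub> A \<star>\<^bsub>I\<^esub> X = X \<and>
     conj_transpose I (M \<star>\<^bsub>I\<^esub> A \<star>\<^bsub>I\<^esub> X) = M \<star>\<^bsub>I\<^esub> A \<star>\<^bsub>I\<^esub> X \<and>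
     conj_transpose I (N \<star>\<^bsub>I\<^esub> X \<star>\<^bsub>I\<^esub> A) = N \<star>\<^bsub>I\<^esub> X \<star>\<^bsub>I\<^esub> A"

text \<open>The description is proper (existence and uniqueness hold) for \<open>A \<in> tensors I\<close> and
  Hermitian positive definite \<open>M\<close> and \<open>N\<close>.\<close>

definition weighted_mp_inverse :: "nat list \<Rightarrow> tensor \<Rightarrow> tensor \<Rightarrow> tensor \<Rightarrow> tensor" where
  "weighted_mp_inverse I M N A = (THE X. is_weighted_mp_inverse I M N A X)"

end

theory Submission
  imports Defs "HOL-Library.Function_Algebras"
begin

text \<open>Let \<open>A\<^sup>\<dagger>\<close>, \<open>B\<^sup>\<dagger>\<close> be the weighted inverses and \<open>P = B B\<^sup>\<dagger>\<close>, \<open>Q = A A\<^sup>\<dagger>\<close>. Since \<open>P\<close> commutes with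
  \<open>A\<close> and \<open>A\<^sup>\<dagger>\<close>, the first two Penrose equations for \<open>B\<^sup>\<dagger> A\<^sup>\<dagger>\<close> are immediate; \<open>M P Q\<close> is Hermitian as
  \<open>P\<close>, \<open>Q\<close> commute and are self-adjoint for \<open>M\<close>; and \<open>N B\<^sup>\<dagger> = B\<^sup>H N\<close> turns \<open>N B\<^sup>\<dagger> A\<^sup>\<dagger> A B\<close> into the congruence
  \<open>B\<^sup>H (N A\<^sup>\<dagger> A) B\<close>. The definite description moreover requires existence: if \<open>W\<close> is an inner inverse of
  \<open>A\<^sup>H M A\<close>, then \<open>Y = W A\<^sup>H M\<close> satisfies \<open>A Y A = A\<close> with \<open>M A Y\<close> Hermitian; dually, working with \<open>A\<^sup>H\<close>
  and \<open>N\<^sup>-\<^sup>1\<close> yields \<open>Z\<close> with \<open>A Z A = A\<close> and \<open>N Z A\<close> Hermitian, and \<open>Z A Y\<close> is the weighted inverse.\<close>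

section \<open>Tensor algebra: Einstein product, identity and conjugate transpose\<close>

lemma finite_multi_indices: "finite (multi_indices I)"
proof (rule finite_subset)
  \<comment> \<open>One bound serves all modes. For \<open>I = []\<close> the value of
    \<open>Max\<close> is unspecified, but then only the empty list remains.\<close>
  show "multi_indices I \<subseteq> {xs. set xs \<subseteq> {..Max (set I)} \<and> length xs = length I}"
  proof (clarsimp simp: multi_indices_def in_set_conv_nth)
    fix xs k assume "\<forall>k<length I. Suc 0 \<le> xs ! k \<and> xs ! k \<le> I ! k" "k < length I"
    moreover from this have "I ! k \<le> Max (set I)"
      by (intro Max_ge) simp_all
    ultimately show "xs ! k \<le> Max (set I)"
      using order_trans by blast
  qed
qed (simp add: finite_lists_length_eq)

lemma tensor_eqI:
  assumes "A \<in> tensors I" "B \<in> tensors I"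
    and "\<And>i j. i \<in> multi_indices I \<Longrightarrow> j \<in> multi_indices I \<Longrightarrow> A (i, j) = B (i, j)"
  shows "A = B"
  using assms(1,2) unfolding tensors_def by (rule PiE_ext) (auto simp: assms(3))

lemma einstein_prod_in_tensors [simp]: "A \<star>\<^bsub>I\<^esub> B \<in> tensors I"
  by (auto simp: einstein_prod_def tensors_def)

lemma conj_transpose_in_tensors [simp]: "conj_transpose I A \<in> tensors I"
  by (auto simp: conj_transpose_def tensors_def)

lemma identity_tensor_in_tensors: "identity_tensor I \<in> tensors I"
  by (auto simp: identity_tensor_def tensors_def)

lemma einstein_prod_entry:
  "i \<in> multi_indices I \<Longrightarrow> k \<in> multi_indices I \<Longrightarrow>
    (A \<star>\<^bsub>I\<^esub> B) (i, k) = (\<Sum>j \<in> multi_indices I. A (i, j) * B (j, k))"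
  by (simp add: einstein_prod_def)

lemma conj_transpose_entry:
  "i \<in> multi_indices I \<Longrightarrow> j \<in> multi_indices I \<Longrightarrow> conj_transpose I A (j, i) = cnj (A (i, j))"
  by (simp add: conj_transpose_def)

lemma identity_tensor_entry:
  assumes "i \<in> multi_indices I" "j \<in> multi_indices I"
  shows "identity_tensor I (i, j) = (if i = j then 1 else 0)"
  using assms by (auto simp: identity_tensor_def multi_indices_def list_eq_iff_nth_eq)

lemma einstein_prod_assoc: "A \<star>\<^bsub>I\<^esub> B \<star>\<^bsub>I\<^esub> C = A \<star>\<^bsub>I\<^esub> (B \<star>\<^bsub>I\<^esub> C)"
proof (rule tensor_eqI[of _ I])
  fix i k assume ik: "i \<in> multi_indices I" "k \<in> multi_indices I"
  have "(A \<star>\<^bsub>I\<^esub> B \<star>\<^bsub>I\<^esub> C) (i, k)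
      = (\<Sum>j\<in>multi_indices I. \<Sum>l\<in>multi_indices I. A (i, l) * (B (l, j) * C (j, k)))"
    using ik by (simp add: einstein_prod_entry sum_distrib_right mult.assoc)
  also have "\<dots> = (A \<star>\<^bsub>I\<^esub> (B \<star>\<^bsub>I\<^esub> C)) (i, k)"
    using ik by (subst sum.swap) (simp add: einstein_prod_entry sum_distrib_left)
  finally show "(A \<star>\<^bsub>I\<^esub> B \<star>\<^bsub>I\<^esub> C) (i, k) = (A \<star>\<^bsub>I\<^esub> (B \<star>\<^bsub>I\<^esub> C)) (i, k)" .
qed simp_all

lemma einstein_prod_identity_left: "A \<in> tensors I \<Longrightarrow> identity_tensor I \<star>\<^bsub>I\<^esub> A = A"
  by (rule tensor_eqI[of _ I])
    (simp_all add: einstein_prod_entry identity_tensor_entry if_distrib[of "\<lambda>x. x * _"]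
      finite_multi_indices cong: if_cong)

lemma einstein_prod_identity_right: "A \<in> tensors I \<Longrightarrow> A \<star>\<^bsub>I\<^esub> identity_tensor I = A"
  by (rule tensor_eqI[of _ I])
    (simp_all add: einstein_prod_entry identity_tensor_entry if_distrib[of "\<lambda>x. _ * x"]
      finite_multi_indices cong: if_cong)

lemma conj_transpose_einstein_prod:
  "conj_transpose I (A \<star>\<^bsub>I\<^esub> B) = conj_transpose I B \<star>\<^bsub>I\<^esub> conj_transpose I A"
  by (rule tensor_eqI[of _ I])
    (simp_all add: einstein_prod_entry conj_transpose_entry mult.commute)

lemma conj_transpose_conj_transpose:
  "A \<in> tensors I \<Longrightarrow> conj_transpose I (conj_transpose I A) = A"
  by (rule tensor_eqI[of _ I]) (simp_all add: conj_transpose_entry)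

section \<open>Hermitian positive definite tensors: symmetry, inversion, definiteness\<close>

lemma diagonal_tensor_sum:
  assumes "diagonal_tensor I D" "i \<in> multi_indices I"
  shows "(\<Sum>k\<in>multi_indices I. D (i, k) * f k) = D (i, i) * f i"
proof -
  have "(\<Sum>k\<in>multi_indices I. D (i, k) * f k)
      = (\<Sum>k\<in>multi_indices I. if k = i then D (i, i) * f i else 0)"
    using assms by (intro sum.cong) (auto simp: diagonal_tensor_def)
  then show ?thesis
    using assms by (simp add: finite_multi_indices)
qed

lemma hermitian_pos_def_hermitian:
  assumes "hermitian_pos_def I M"
  shows "conj_transpose I M = M"
proof -
  obtain U D where U: "U \<in> tensors I" and D: "diagonal_tensor I D"
      "\<forall>i \<in> multi_indices I. D (i, i) \<in> \<real>"
    and M: "M = U \<star>\<^bsub>I\<^esub> D \<star>\<^bsub>I\<^esub> conj_transpose I U"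
    using assms by (auto simp: hermitian_pos_def_def unitary_tensor_def)
  have "conj_transpose I D = D"
  proof (rule tensor_eqI[of _ I])
    fix i j assume "i \<in> multi_indices I" "j \<in> multi_indices I"
    then show "conj_transpose I D (i, j) = D (i, j)"
      using D by (cases "i = j") (auto simp: conj_transpose_entry diagonal_tensor_def Reals_cnj_iff)
  qed (use D in \<open>simp_all add: diagonal_tensor_def\<close>)
  then show ?thesis
    by (simp add: M conj_transpose_einstein_prod conj_transpose_conj_transpose U einstein_prod_assoc)
qed

text \<open>Inverting the diagonal in \<open>M = U D U^H\<close> and keeping \<open>U\<close> gives
  the inverse. Its positive definiteness matters because it later serves as a weight itself.\<close>

lemma hermitian_pos_def_inverse:
  assumes "hermitian_pos_def I M"
  obtains L where "hermitian_pos_def I L"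
    "M \<star>\<^bsub>I\<^esub> L = identity_tensor I" "L \<star>\<^bsub>I\<^esub> M = identity_tensor I"
proof -
  obtain U D where U: "unitary_tensor I U" and D: "diagonal_tensor I D"
      and pos: "\<And>i. i \<in> multi_indices I \<Longrightarrow> D (i, i) \<in> \<real> \<and> Re (D (i, i)) > 0"
    and M: "M = U \<star>\<^bsub>I\<^esub> D \<star>\<^bsub>I\<^esub> conj_transpose I U"
    using assms by (auto simp: hermitian_pos_def_def)
  define E :: tensor where
    "E = (\<lambda>(i, j) \<in> multi_indices I \<times> multi_indices I. if i = j then inverse (D (i, i)) else 0)"
  define L where "L = U \<star>\<^bsub>I\<^esub> E \<star>\<^bsub>I\<^esub> conj_transpose I U"
  have nz: "D (i, i) \<noteq> 0" if "i \<in> multi_indices I" for i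
    using pos[OF that] by auto
  have E: "diagonal_tensor I E"
    by (auto simp: diagonal_tensor_def E_def tensors_def)
  have E_entry: "E (i, i) = inverse (D (i, i))" if "i \<in> multi_indices I" for i
    using that by (simp add: E_def)
  have posE: "E (i, i) \<in> \<real> \<and> Re (E (i, i)) > 0" if "i \<in> multi_indices I" for i
    using pos[OF that] by (auto simp: E_entry that elim!: Reals_cases)
  \<comment> \<open>General \<open>F\<close>, \<open>G\<close> make this fact cover both
    \<open>D E\<close> and \<open>E D\<close>.\<close>
  have DE: "F \<star>\<^bsub>I\<^esub> G = identity_tensor I"
    if "diagonal_tensor I F" "diagonal_tensor I G"
      "\<And>i. i \<in> multi_indices I \<Longrightarrow> F (i, i) * G (i, i) = 1" for F G
  proof (rule tensor_eqI[of _ I])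
    fix i j assume "i \<in> multi_indices I" "j \<in> multi_indices I"
    then show "(F \<star>\<^bsub>I\<^esub> G) (i, j) = identity_tensor I (i, j)"
      using that by (cases "i = j") (simp_all add: einstein_prod_entry identity_tensor_entry
          diagonal_tensor_sum[of I F], simp add: diagonal_tensor_def)
  qed (simp_all add: identity_tensor_in_tensors)
  have UU: "conj_transpose I U \<star>\<^bsub>I\<^esub> (U \<star>\<^bsub>I\<^esub> X) = X" if "X \<in> tensors I" for X
    using U that by (simp add: unitary_tensor_def einstein_prod_identity_left
        flip: einstein_prod_assoc)
  \<comment> \<open>The inner \<open>U^H U\<close> collapses, then \<open>F G\<close>, and
    \<open>U U^H\<close> remains.\<close>
  have cancel: "U \<star>\<^bsub>I\<^esub> F \<star>\<^bsub>I\<^esub> conj_transpose I U \<star>\<^bsub>I\<^esub> (U \<star>\<^bsub>I\<^esub> G \<star>\<^bsub>I\<^esub> conj_transpose I U)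
      = identity_tensor I" if "F \<star>\<^bsub>I\<^esub> G = identity_tensor I" for F G
  proof -
    have "F \<star>\<^bsub>I\<^esub> (G \<star>\<^bsub>I\<^esub> conj_transpose I U) = conj_transpose I U"
      by (simp add: that einstein_prod_identity_left flip: einstein_prod_assoc)
    then show ?thesis
      using U by (simp add: UU einstein_prod_assoc unitary_tensor_def)
  qed
  show thesis
  proof
    show "hermitian_pos_def I L"
      unfolding hermitian_pos_def_def using U E posE L_def by (metis einstein_prod_in_tensors)
  qed (simp_all add: M L_def cancel DE D E E_entry nz)
qed

text \<open>With \<open>w = U^H v\<close> the quadratic form becomes the sum of
  \<open>D (l, l) * |w l|^2\<close>. Its terms are nonnegative, so all vanish; hence
  \<open>w = 0\<close> and \<open>v = U w = 0\<close>.\<close>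

lemma hermitian_pos_def_definite:
  assumes "hermitian_pos_def I M"
    and zero: "(\<Sum>i\<in>multi_indices I. cnj (v i) * (\<Sum>j\<in>multi_indices I. M (i, j) * v j)) = 0"
    and i: "i \<in> multi_indices I"
  shows "v i = 0"
proof -
  let ?K = "multi_indices I"
  obtain U D where U: "unitary_tensor I U" and D: "diagonal_tensor I D"
      and pos: "\<And>i. i \<in> multi_indices I \<Longrightarrow> D (i, i) \<in> \<real> \<and> Re (D (i, i)) > 0"
    and M: "M = U \<star>\<^bsub>I\<^esub> D \<star>\<^bsub>I\<^esub> conj_transpose I U"
    using assms by (auto simp: hermitian_pos_def_def)
  \<comment> \<open>The coordinates of \<open>v\<close> in the eigenbasis formed by the columns of
    \<open>U\<close>.\<close>
  define w where "w l = (\<Sum>j\<in>?K. cnj (U (j, l)) * v j)" for l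
  have Mv: "(\<Sum>j\<in>?K. M (i, j) * v j) = (\<Sum>l\<in>?K. U (i, l) * (D (l, l) * w l))"
    if "i \<in> ?K" for i
  proof -
    have "M (i, j) = (\<Sum>l\<in>?K. U (i, l) * (D (l, l) * cnj (U (j, l))))" if "j \<in> ?K" for j
      using \<open>i \<in> ?K\<close> that
      by (simp add: M einstein_prod_assoc einstein_prod_entry diagonal_tensor_sum[OF D]
          conj_transpose_entry)
    then have "(\<Sum>j\<in>?K. M (i, j) * v j)
        = (\<Sum>j\<in>?K. \<Sum>l\<in>?K. U (i, l) * (D (l, l) * (cnj (U (j, l)) * v j)))"
      by (simp add: sum_distrib_right mult.assoc)
    also have "\<dots> = (\<Sum>l\<in>?K. U (i, l) * (D (l, l) * w l))"
      by (subst sum.swap) (simp add: w_def sum_distrib_left)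
    finally show ?thesis .
  qed
  have cnj_w: "cnj (w l) = (\<Sum>i\<in>?K. cnj (v i) * U (i, l))" for l
    by (simp add: w_def mult.commute)
  have "0 = (\<Sum>i\<in>?K. \<Sum>l\<in>?K. cnj (v i) * U (i, l) * (D (l, l) * w l))"
    using zero by (simp add: Mv sum_distrib_left mult.assoc)
  also have "\<dots> = (\<Sum>l\<in>?K. cnj (w l) * (D (l, l) * w l))"
    by (subst sum.swap) (simp add: cnj_w flip: sum_distrib_right)
  finally have "(\<Sum>l\<in>?K. Re (cnj (w l) * (D (l, l) * w l))) = 0"
    by (metis Re_sum zero_complex.sel(1))
  moreover have Re_eq: "Re (cnj (w l) * (D (l, l) * w l)) = Re (D (l, l)) * (cmod (w l))\<^sup>2"
    if l: "l \<in> ?K" for l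
  proof -
    obtain d where "D (l, l) = complex_of_real d"
      using pos[OF l] by (meson Reals_cases)
    then show ?thesis
      by (simp add: cmod_power2) (simp add: power2_eq_square algebra_simps)
  qed
  ultimately have "(\<Sum>l\<in>?K. Re (D (l, l)) * (cmod (w l))\<^sup>2) = 0"
    by simp
  then have "\<forall>l\<in>?K. Re (D (l, l)) * (cmod (w l))\<^sup>2 = 0"
    by (subst (asm) sum_nonneg_eq_0_iff)
      (auto simp: finite_multi_indices intro!: mult_nonneg_nonneg dest!: pos)
  then have w0: "w l = 0" if "l \<in> ?K" for l
    using pos[OF that] that by auto
  \<comment> \<open>Recover \<open>v\<close> from its coordinates by writing the identity as
    \<open>U U^H\<close>.\<close>
  have "v i = (\<Sum>j\<in>?K. identity_tensor I (i, j) * v j)"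
    using i by (simp add: identity_tensor_entry if_distrib[of "\<lambda>x. x * _"]
        finite_multi_indices cong: if_cong)
  also have "\<dots> = (\<Sum>j\<in>?K. \<Sum>l\<in>?K. U (i, l) * (cnj (U (j, l)) * v j))"
    using U[unfolded unitary_tensor_def, THEN conjunct2, THEN conjunct1, symmetric] i
    by (simp add: einstein_prod_entry conj_transpose_entry sum_distrib_right mult.assoc)
  also have "\<dots> = (\<Sum>l\<in>?K. U (i, l) * w l)"
    by (subst sum.swap) (simp add: w_def sum_distrib_left)
  finally show ?thesis
    by (simp add: w0)
qed

text \<open>For each column \<open>v\<close> of \<open>A Y - A Z\<close>, the hypothesis says
  \<open>A^H M v = 0\<close>. Since \<open>v = A u\<close> for a column \<open>u\<close> of
  \<open>Y - Z\<close>, also \<open>v^H M v = u^H A^H M v = 0\<close>, and definiteness gives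
  \<open>v = 0\<close>.\<close>

lemma hermitian_pos_def_cancel:
  assumes M: "hermitian_pos_def I M"
    and eq: "conj_transpose I A \<star>\<^bsub>I\<^esub> M \<star>\<^bsub>I\<^esub> A \<star>\<^bsub>I\<^esub> Y = conj_transpose I A \<star>\<^bsub>I\<^esub> M \<star>\<^bsub>I\<^esub> A \<star>\<^bsub>I\<^esub> Z"
  shows "A \<star>\<^bsub>I\<^esub> Y = A \<star>\<^bsub>I\<^esub> Z"
proof (rule tensor_eqI[of _ I])
  let ?K = "multi_indices I"
  fix i k assume ik: "i \<in> ?K" "k \<in> ?K"
  define v where "v j = (A \<star>\<^bsub>I\<^esub> Y) (j, k) - (A \<star>\<^bsub>I\<^esub> Z) (j, k)" for j
  define u where "u l = Y (l, k) - Z (l, k)" for l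
  define x where "x j = (\<Sum>j'\<in>?K. M (j, j') * v j')" for j
  have v: "v j = (\<Sum>l\<in>?K. A (j, l) * u l)" if "j \<in> ?K" for j
    using that ik by (simp add: v_def u_def einstein_prod_entry sum_subtractf algebra_simps)
  have x: "x j = (M \<star>\<^bsub>I\<^esub> (A \<star>\<^bsub>I\<^esub> Y)) (j, k) - (M \<star>\<^bsub>I\<^esub> (A \<star>\<^bsub>I\<^esub> Z)) (j, k)" if "j \<in> ?K" for j
    unfolding x_def v_def using that ik
    by (subst (1 2) einstein_prod_entry) (simp_all add: sum_subtractf algebra_simps)
  have A_x: "(\<Sum>j\<in>?K. cnj (A (j, l)) * x j) = 0" if "l \<in> ?K" for l
  proof -
    have "(\<Sum>j\<in>?K. cnj (A (j, l)) * x j)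
        = (conj_transpose I A \<star>\<^bsub>I\<^esub> (M \<star>\<^bsub>I\<^esub> (A \<star>\<^bsub>I\<^esub> Y))) (l, k)
          - (conj_transpose I A \<star>\<^bsub>I\<^esub> (M \<star>\<^bsub>I\<^esub> (A \<star>\<^bsub>I\<^esub> Z))) (l, k)"
      using that ik by (simp add: x conj_transpose_entry sum_subtractf algebra_simps
          einstein_prod_entry[of _ _ _ "conj_transpose I A"])
    then show ?thesis
      using eq by (simp add: einstein_prod_assoc)
  qed
  have "(\<Sum>j\<in>?K. cnj (v j) * x j) = (\<Sum>j\<in>?K. \<Sum>l\<in>?K. cnj (u l) * (cnj (A (j, l)) * x j))"
    by (simp add: v sum_distrib_right sum_distrib_left ac_simps)
  also have "\<dots> = 0"
    by (subst sum.swap) (simp add: A_x flip: sum_distrib_left)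
  finally have "v i = 0"
    using hermitian_pos_def_definite[OF M _ ik(1), of v] by (simp add: x_def)
  then show "(A \<star>\<^bsub>I\<^esub> Y) (i, k) = (A \<star>\<^bsub>I\<^esub> Z) (i, k)"
    by (simp add: v_def)
qed simp_all

section \<open>Existence of the weighted inverse\<close>

lemma inner_inverse_exists:
  assumes A: "A \<in> tensors I"
  obtains W where "W \<in> tensors I" "A \<star>\<^bsub>I\<^esub> W \<star>\<^bsub>I\<^esub> A = A"
proof -
  let ?K = "multi_indices I"
  \<comment> \<open>\<open>A\<close> is viewed as a linear map on the space of all functions on
    lists, with pointwise operations, so that abstract linear algebra applies.\<close>
  define sc :: "complex \<Rightarrow> (nat list \<Rightarrow> complex) \<Rightarrow> nat list \<Rightarrow> complex" where
    "sc c v = (\<lambda>i. c * v i)" for c v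
  interpret V: vector_space sc
    by unfold_locales (auto simp: sc_def fun_eq_iff algebra_simps)
  interpret VV: vector_space_pair sc sc ..
  have sum_apply: "sum F S x = (\<Sum>s\<in>S. F s x)" if "finite S"
    for F :: "nat list \<Rightarrow> nat list \<Rightarrow> complex" and S x
    using that by induction auto
  \<comment> \<open>Multiplication by \<open>A\<close>: coordinates outside \<open>?K\<close> are
    ignored in the input and set to 0 in the output.\<close>
  define f :: "(nat list \<Rightarrow> complex) \<Rightarrow> nat list \<Rightarrow> complex" where
    "f v = (\<lambda>i. if i \<in> ?K then \<Sum>j\<in>?K. A (i, j) * v j else 0)" for v
  have lin: "Vector_Spaces.linear sc sc f"
    by unfold_locales
      (auto simp: f_def sc_def fun_eq_iff algebra_simps sum.distrib sum_distrib_left)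
  \<comment> \<open>A linear right inverse \<open>g\<close> of \<open>f\<close> on the range of
    \<open>f\<close> satisfies \<open>f g f = f\<close>; read as a tensor, this is the
    claim.\<close>
  obtain g where g: "Vector_Spaces.linear sc sc g" "\<And>v. f (g (f v)) = f v"
    using VV.linear_exists_right_inverse_on[OF lin V.subspace_UNIV] by auto
  interpret g: Vector_Spaces.linear sc sc g by (fact g(1))
  \<comment> \<open>Unit vectors; \<open>W\<close> is the matrix of \<open>g\<close> with respect to
    them, cut down to \<open>?K\<close>.\<close>
  define e :: "nat list \<Rightarrow> nat list \<Rightarrow> complex" where "e j = (\<lambda>i. if i = j then 1 else 0)" for j
  define W :: tensor where "W = (\<lambda>(i, j) \<in> ?K \<times> ?K. g (e j) i)"
  show thesis
  proof
    show "W \<in> tensors I"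
      by (auto simp: W_def tensors_def)
    show "A \<star>\<^bsub>I\<^esub> W \<star>\<^bsub>I\<^esub> A = A"
    proof (rule tensor_eqI[of _ I])
      fix i k assume ik: "i \<in> ?K" "k \<in> ?K"
      \<comment> \<open>Column \<open>k\<close> of \<open>A\<close> as a finite combination of unit
        vectors, so that linearity carries \<open>g\<close> through the sum.\<close>
      have fe: "f (e k) = (\<Sum>j\<in>?K. sc (A (j, k)) (e j))"
        using ik by (auto simp: fun_eq_iff f_def sum_apply finite_multi_indices sc_def e_def
            if_distrib[of "\<lambda>x. _ * x"] cong: if_cong)
      have "(A \<star>\<^bsub>I\<^esub> W \<star>\<^bsub>I\<^esub> A) (i, k) = (\<Sum>l\<in>?K. A (i, l) * (\<Sum>j\<in>?K. A (j, k) * g (e j) l))"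
        using ik by (simp add: einstein_prod_assoc einstein_prod_entry W_def mult.commute)
      also have "\<dots> = f (g (f (e k))) i"
        using ik by (simp add: fe g.sum g.scale)
          (simp add: f_def sum_apply finite_multi_indices sc_def)
      also have "\<dots> = A (i, k)"
        using ik by (simp add: g(2))
          (simp add: f_def e_def if_distrib[of "\<lambda>x. _ * x"] finite_multi_indices cong: if_cong)
      finally show "(A \<star>\<^bsub>I\<^esub> W \<star>\<^bsub>I\<^esub> A) (i, k) = A (i, k)" .
    qed (simp_all add: A)
  qed
qed

text \<open>This is weighted least squares: \<open>S = A^H M A\<close> is the Gram tensor of
  \<open>A\<close>, and \<open>W A^H M\<close> solves the normal equations. The symmetry of
  \<open>M A Y = M (A W A^H) M\<close> rests on that of \<open>A W A^H\<close>, although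
  \<open>W\<close> itself may fail to be Hermitian.\<close>

lemma weighted_13_inverse_exists:
  assumes A: "A \<in> tensors I" and M: "hermitian_pos_def I M"
  obtains Y where "Y \<in> tensors I" "A \<star>\<^bsub>I\<^esub> Y \<star>\<^bsub>I\<^esub> A = A"
    "conj_transpose I (M \<star>\<^bsub>I\<^esub> A \<star>\<^bsub>I\<^esub> Y) = M \<star>\<^bsub>I\<^esub> A \<star>\<^bsub>I\<^esub> Y"
proof -
  let ?H = "conj_transpose I"
  define S where "S = ?H A \<star>\<^bsub>I\<^esub> M \<star>\<^bsub>I\<^esub> A"
  have H_M: "?H M = M"
    using M by (rule hermitian_pos_def_hermitian)
  have H_S: "?H S = S"
    using A by (simp add: S_def conj_transpose_einstein_prod conj_transpose_conj_transpose H_M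
        einstein_prod_assoc)
  obtain W where W: "W \<in> tensors I" "S \<star>\<^bsub>I\<^esub> W \<star>\<^bsub>I\<^esub> S = S"
    by (rule inner_inverse_exists[of S I]) (auto simp: S_def)
  \<comment> \<open>Compare \<open>S (Z S)\<close> with \<open>S I\<close>: cancelling
    \<open>A^H M\<close> on the left leaves \<open>A (Z S) = A\<close>.\<close>
  have cancel: "A \<star>\<^bsub>I\<^esub> Z \<star>\<^bsub>I\<^esub> S = A" if "S \<star>\<^bsub>I\<^esub> Z \<star>\<^bsub>I\<^esub> S = S" for Z
  proof -
    have "A \<star>\<^bsub>I\<^esub> (Z \<star>\<^bsub>I\<^esub> S) = A \<star>\<^bsub>I\<^esub> identity_tensor I"
      using that by - (rule hermitian_pos_def_cancel[OF M],
        simp add: einstein_prod_identity_right S_def flip: einstein_prod_assoc)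
    then show ?thesis
      using A by (simp add: einstein_prod_identity_right einstein_prod_assoc)
  qed
  \<comment> \<open>Since \<open>S\<close> is Hermitian, \<open>W^H\<close> is an inner inverse of
    \<open>S\<close> too.\<close>
  have "S \<star>\<^bsub>I\<^esub> ?H W \<star>\<^bsub>I\<^esub> S = S"
    using arg_cong[OF W(2), of ?H] by (simp add: conj_transpose_einstein_prod H_S einstein_prod_assoc)
  then have AWS': "A \<star>\<^bsub>I\<^esub> ?H W \<star>\<^bsub>I\<^esub> S = A"
    by (rule cancel)
  have SWA: "S \<star>\<^bsub>I\<^esub> W \<star>\<^bsub>I\<^esub> ?H A = ?H A"
    using arg_cong[OF AWS', of ?H] W(1)
    by (simp add: conj_transpose_einstein_prod H_S conj_transpose_conj_transpose einstein_prod_assoc)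
  \<comment> \<open>Evaluate \<open>A W^H S W A^H\<close> in two ways: \<open>A W^H S = A\<close>
    gives \<open>A W A^H\<close>, while \<open>S W A^H = A^H\<close> gives \<open>A W^H A^H\<close>.
    Hence \<open>A W A^H\<close> is Hermitian.\<close>
  have "A \<star>\<^bsub>I\<^esub> W \<star>\<^bsub>I\<^esub> ?H A = A \<star>\<^bsub>I\<^esub> ?H W \<star>\<^bsub>I\<^esub> (S \<star>\<^bsub>I\<^esub> W \<star>\<^bsub>I\<^esub> ?H A)"
    by (simp add: AWS' flip: einstein_prod_assoc)
  then have AWA: "A \<star>\<^bsub>I\<^esub> (?H W \<star>\<^bsub>I\<^esub> ?H A) = A \<star>\<^bsub>I\<^esub> (W \<star>\<^bsub>I\<^esub> ?H A)"
    unfolding SWA by (simp only: einstein_prod_assoc)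
  show thesis
  proof
    let ?Y = "W \<star>\<^bsub>I\<^esub> ?H A \<star>\<^bsub>I\<^esub> M"
    show "A \<star>\<^bsub>I\<^esub> ?Y \<star>\<^bsub>I\<^esub> A = A"
      using cancel[OF W(2)] by (simp add: S_def einstein_prod_assoc)
    have "?H (M \<star>\<^bsub>I\<^esub> A \<star>\<^bsub>I\<^esub> ?Y) = M \<star>\<^bsub>I\<^esub> (A \<star>\<^bsub>I\<^esub> (?H W \<star>\<^bsub>I\<^esub> ?H A)) \<star>\<^bsub>I\<^esub> M"
      using A by (simp add: conj_transpose_einstein_prod conj_transpose_conj_transpose H_M
          einstein_prod_assoc)
    then show "?H (M \<star>\<^bsub>I\<^esub> A \<star>\<^bsub>I\<^esub> ?Y) = M \<star>\<^bsub>I\<^esub> A \<star>\<^bsub>I\<^esub> ?Y"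
      by (simp add: AWA einstein_prod_assoc)
  qed simp
qed

text \<open>Duality: if \<open>Y\<close> is the inverse of the previous lemma for \<open>A^H\<close>
  with weight \<open>L = N^-1\<close>, then \<open>Z = Y^H\<close> works for \<open>A\<close> with
  weight \<open>N\<close>.\<close>

lemma weighted_14_inverse_exists:
  assumes A: "A \<in> tensors I" and N: "hermitian_pos_def I N"
  obtains Z where "Z \<in> tensors I" "A \<star>\<^bsub>I\<^esub> Z \<star>\<^bsub>I\<^esub> A = A"
    "conj_transpose I (N \<star>\<^bsub>I\<^esub> Z \<star>\<^bsub>I\<^esub> A) = N \<star>\<^bsub>I\<^esub> Z \<star>\<^bsub>I\<^esub> A"
proof -
  let ?H = "conj_transpose I"
  obtain L where L: "hermitian_pos_def I L" "L \<star>\<^bsub>I\<^esub> N = identity_tensor I"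
      and NL: "N \<star>\<^bsub>I\<^esub> L = identity_tensor I"
    using hermitian_pos_def_inverse[OF N] by metis
  note herm = hermitian_pos_def_hermitian[OF L(1)] hermitian_pos_def_hermitian[OF N]
  obtain Y where Y: "Y \<in> tensors I" "?H A \<star>\<^bsub>I\<^esub> Y \<star>\<^bsub>I\<^esub> ?H A = ?H A"
    "?H (L \<star>\<^bsub>I\<^esub> ?H A \<star>\<^bsub>I\<^esub> Y) = L \<star>\<^bsub>I\<^esub> ?H A \<star>\<^bsub>I\<^esub> Y"
    using weighted_13_inverse_exists[OF conj_transpose_in_tensors L(1)] by metis
  have AYA: "A \<star>\<^bsub>I\<^esub> ?H Y \<star>\<^bsub>I\<^esub> A = A"
    using arg_cong[OF Y(2), of ?H] A
    by (simp add: conj_transpose_einstein_prod conj_transpose_conj_transpose einstein_prod_assoc)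
  \<comment> \<open>This is the symmetry of \<open>L A^H Y\<close>, spelled out.\<close>
  have YAL: "?H Y \<star>\<^bsub>I\<^esub> (A \<star>\<^bsub>I\<^esub> L) = L \<star>\<^bsub>I\<^esub> (?H A \<star>\<^bsub>I\<^esub> Y)"
    using Y(3) A by (simp add: conj_transpose_einstein_prod conj_transpose_conj_transpose herm
        einstein_prod_assoc)
  \<comment> \<open>Inserting \<open>L N = I\<close> exposes \<open>Y^H A L\<close>; the exchange
    then yields \<open>A^H Y N\<close>, the conjugate transpose of the starting term.\<close>
  have "N \<star>\<^bsub>I\<^esub> ?H Y \<star>\<^bsub>I\<^esub> A = N \<star>\<^bsub>I\<^esub> (?H Y \<star>\<^bsub>I\<^esub> (A \<star>\<^bsub>I\<^esub> L)) \<star>\<^bsub>I\<^esub> N"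
    using A by (simp add: einstein_prod_assoc L einstein_prod_identity_right)
  also have "\<dots> = N \<star>\<^bsub>I\<^esub> L \<star>\<^bsub>I\<^esub> (?H A \<star>\<^bsub>I\<^esub> Y \<star>\<^bsub>I\<^esub> N)"
    by (simp add: YAL einstein_prod_assoc)
  also have "\<dots> = ?H A \<star>\<^bsub>I\<^esub> Y \<star>\<^bsub>I\<^esub> N"
    by (simp add: NL einstein_prod_identity_left)
  also have "\<dots> = ?H (N \<star>\<^bsub>I\<^esub> ?H Y \<star>\<^bsub>I\<^esub> A)"
    using Y(1) by (simp add: conj_transpose_einstein_prod conj_transpose_conj_transpose herm
        einstein_prod_assoc)
  finally show thesis
    using AYA by (intro that[of "?H Y"]) simp_all
qed

text \<open>For \<open>X = Z A Y\<close>, \<open>A X = A Y\<close> and \<open>X A = Z A\<close>, so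
  \<open>X\<close> inherits the \<open>M\<close>-symmetry from \<open>Y\<close> and the
  \<open>N\<close>-symmetry from \<open>Z\<close>.\<close>

lemma weighted_mp_inverse_exists:
  assumes A: "A \<in> tensors I" and M: "hermitian_pos_def I M" and N: "hermitian_pos_def I N"
  shows "\<exists>X. is_weighted_mp_inverse I M N A X"
proof -
  let ?H = "conj_transpose I"
  obtain Y where Y: "A \<star>\<^bsub>I\<^esub> Y \<star>\<^bsub>I\<^esub> A = A" "?H (M \<star>\<^bsub>I\<^esub> A \<star>\<^bsub>I\<^esub> Y) = M \<star>\<^bsub>I\<^esub> A \<star>\<^bsub>I\<^esub> Y"
    using weighted_13_inverse_exists[OF A M] by metis
  obtain Z where Z: "A \<star>\<^bsub>I\<^esub> Z \<star>\<^bsub>I\<^esub> A = A" "?H (N \<star>\<^bsub>I\<^esub> Z \<star>\<^bsub>I\<^esub> A) = N \<star>\<^bsub>I\<^esub> Z \<star>\<^bsub>I\<^esub> A"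
    using weighted_14_inverse_exists[OF A N] by metis
  let ?X = "Z \<star>\<^bsub>I\<^esub> A \<star>\<^bsub>I\<^esub> Y"
  have AX: "A \<star>\<^bsub>I\<^esub> ?X = A \<star>\<^bsub>I\<^esub> Y"
    using Z(1) by (simp flip: einstein_prod_assoc)
  have XA: "?X \<star>\<^bsub>I\<^esub> A = Z \<star>\<^bsub>I\<^esub> A"
    using Y(1) by (simp add: einstein_prod_assoc)
  have "?X \<star>\<^bsub>I\<^esub> A \<star>\<^bsub>I\<^esub> ?X = Z \<star>\<^bsub>I\<^esub> (A \<star>\<^bsub>I\<^esub> Z \<star>\<^bsub>I\<^esub> A) \<star>\<^bsub>I\<^esub> Y"
    unfolding XA by (simp only: einstein_prod_assoc)
  then have "?X \<star>\<^bsub>I\<^esub> A \<star>\<^bsub>I\<^esub> ?X = ?X"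
    by (simp only: Z(1))
  then have "is_weighted_mp_inverse I M N A ?X"
    unfolding is_weighted_mp_inverse_def einstein_prod_assoc[of M] einstein_prod_assoc[of N] AX XA
    using Y Z by (simp add: einstein_prod_assoc[of M] einstein_prod_assoc[of N])
  then show ?thesis
    by blast
qed

section \<open>Uniqueness of the weighted inverse, via weighted projections\<close>

lemma hermitian_pos_def_left_cancel:
  assumes M: "hermitian_pos_def I M" and eq: "M \<star>\<^bsub>I\<^esub> A = M \<star>\<^bsub>I\<^esub> B"
    and AB: "A \<in> tensors I" "B \<in> tensors I"
  shows "A = B"
proof -
  obtain L where "L \<star>\<^bsub>I\<^esub> M = identity_tensor I"
    using hermitian_pos_def_inverse[OF M] by metis
  then show ?thesis
    using arg_cong[OF eq, of "\<lambda>X. L \<star>\<^bsub>I\<^esub> X"] AB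
    by (simp add: einstein_prod_identity_left flip: einstein_prod_assoc)
qed

text \<open>Idempotents that are self-adjoint for \<open>M\<close> are determined by either their range or their kernel.\<close>

lemma weighted_projection_eqI:
  assumes M: "hermitian_pos_def I M" and PQ: "P \<in> tensors I" "Q \<in> tensors I"
    and P: "conj_transpose I (M \<star>\<^bsub>I\<^esub> P) = M \<star>\<^bsub>I\<^esub> P"
    and Q: "conj_transpose I (M \<star>\<^bsub>I\<^esub> Q) = M \<star>\<^bsub>I\<^esub> Q"
    and "P \<star>\<^bsub>I\<^esub> Q = Q \<and> Q \<star>\<^bsub>I\<^esub> P = P \<or> P \<star>\<^bsub>I\<^esub> Q = P \<and> Q \<star>\<^bsub>I\<^esub> P = Q"
  shows "P = Q"
proof -
  let ?H = "conj_transpose I"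
  have M_H: "?H M = M"
    using M by (rule hermitian_pos_def_hermitian)
  \<comment> \<open>Conjugate transposition swaps \<open>P\<close> and \<open>Q\<close> here, so
    either alternative reduces this equation to \<open>M P = M Q\<close>.\<close>
  have "?H (M \<star>\<^bsub>I\<^esub> (P \<star>\<^bsub>I\<^esub> Q)) = M \<star>\<^bsub>I\<^esub> (Q \<star>\<^bsub>I\<^esub> P)"
    using P Q M_H by (metis conj_transpose_einstein_prod einstein_prod_assoc)
  then have "M \<star>\<^bsub>I\<^esub> P = M \<star>\<^bsub>I\<^esub> Q"
    using assms(6) P Q by auto
  then show ?thesis
    using hermitian_pos_def_left_cancel[OF M _ PQ] by blast
qed

text \<open>The projections \<open>A X\<close> and \<open>A Y\<close> share the range of
  \<open>A\<close>, while \<open>X A\<close> and \<open>Y A\<close> share its kernel; so they agree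
  in pairs. Then \<open>X = X A X = X A Y = Y A Y = Y\<close>.\<close>

lemma weighted_mp_inverse_unique:
  assumes M: "hermitian_pos_def I M" and N: "hermitian_pos_def I N"
    and X: "is_weighted_mp_inverse I M N A X" and Y: "is_weighted_mp_inverse I M N A Y"
  shows "X = Y"
proof -
  note X' = X[unfolded is_weighted_mp_inverse_def einstein_prod_assoc]
  note Y' = Y[unfolded is_weighted_mp_inverse_def einstein_prod_assoc]
  have absorb: "A \<star>\<^bsub>I\<^esub> (X \<star>\<^bsub>I\<^esub> (A \<star>\<^bsub>I\<^esub> Z)) = A \<star>\<^bsub>I\<^esub> Z" "A \<star>\<^bsub>I\<^esub> (Y \<star>\<^bsub>I\<^esub> (A \<star>\<^bsub>I\<^esub> Z)) = A \<star>\<^bsub>I\<^esub> Z" for Z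
    using X' Y' by (metis einstein_prod_assoc)+
  have "A \<star>\<^bsub>I\<^esub> X = A \<star>\<^bsub>I\<^esub> Y"
    by (rule weighted_projection_eqI[OF M])
      (use X' Y' in \<open>simp_all add: einstein_prod_assoc absorb\<close>)
  moreover have "X \<star>\<^bsub>I\<^esub> A = Y \<star>\<^bsub>I\<^esub> A"
    by (rule weighted_projection_eqI[OF N])
      (use X' Y' in \<open>simp_all add: einstein_prod_assoc\<close>)
  ultimately show ?thesis
    using X' Y' by (metis einstein_prod_assoc)
qed

section \<open>The weighted inverse as a definite description\<close>

lemma weighted_mp_inverse_eqI:
  assumes "hermitian_pos_def I M" "hermitian_pos_def I N" "is_weighted_mp_inverse I M N A X"
  shows "weighted_mp_inverse I M N A = X"
  unfolding weighted_mp_inverse_def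
  using assms weighted_mp_inverse_unique by (intro the_equality) blast+

lemma is_weighted_mp_inverse_weighted_mp_inverse:
  assumes "A \<in> tensors I" "hermitian_pos_def I M" "hermitian_pos_def I N"
  shows "is_weighted_mp_inverse I M N A (weighted_mp_inverse I M N A)"
  using weighted_mp_inverse_exists[OF assms] weighted_mp_inverse_eqI[OF assms(2,3)] by metis

section \<open>The reverse-order law\<close>

theorem theorem4p5:
  fixes I :: "nat list" and A B M N :: tensor
  assumes "A \<in> tensors I" and "B \<in> tensors I"
    and "hermitian_pos_def I M" and "hermitian_pos_def I N"
    and "N \<star>\<^bsub>I\<^esub> weighted_mp_inverse I M N B = conj_transpose I (N \<star>\<^bsub>I\<^esub> B)"
    and "A \<star>\<^bsub>I\<^esub> (B \<star>\<^bsub>I\<^esub> weighted_mp_inverse I M N B)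
       = (B \<star>\<^bsub>I\<^esub> weighted_mp_inverse I M N B) \<star>\<^bsub>I\<^esub> A"
    and "weighted_mp_inverse I M N A \<star>\<^bsub>I\<^esub> (B \<star>\<^bsub>I\<^esub> weighted_mp_inverse I M N B)
       = (B \<star>\<^bsub>I\<^esub> weighted_mp_inverse I M N B) \<star>\<^bsub>I\<^esub> weighted_mp_inverse I M N A"
  shows "weighted_mp_inverse I M N (A \<star>\<^bsub>I\<^esub> B)
       = weighted_mp_inverse I M N B \<star>\<^bsub>I\<^esub> weighted_mp_inverse I M N A"
proof -
  let ?H = "conj_transpose I"
  define X where "X = weighted_mp_inverse I M N A"
  define Y where "Y = weighted_mp_inverse I M N B"
  define P where "P = B \<star>\<^bsub>I\<^esub> Y"
  define Q where "Q = A \<star>\<^bsub>I\<^esub> X"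
  have H_M: "?H M = M" and H_N: "?H N = N"
    using assms(3,4) by (simp_all add: hermitian_pos_def_hermitian)
  have X: "A \<star>\<^bsub>I\<^esub> (X \<star>\<^bsub>I\<^esub> A) = A" "X \<star>\<^bsub>I\<^esub> (A \<star>\<^bsub>I\<^esub> X) = X" "?H (M \<star>\<^bsub>I\<^esub> Q) = M \<star>\<^bsub>I\<^esub> Q"
      "?H (N \<star>\<^bsub>I\<^esub> (X \<star>\<^bsub>I\<^esub> A)) = N \<star>\<^bsub>I\<^esub> (X \<star>\<^bsub>I\<^esub> A)"
    using is_weighted_mp_inverse_weighted_mp_inverse[OF assms(1,3,4), folded X_def]
    unfolding is_weighted_mp_inverse_def einstein_prod_assoc Q_def by auto
  have Y: "P \<star>\<^bsub>I\<^esub> B = B" "Y \<star>\<^bsub>I\<^esub> P = Y" "?H (M \<star>\<^bsub>I\<^esub> P) = M \<star>\<^bsub>I\<^esub> P"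
    using is_weighted_mp_inverse_weighted_mp_inverse[OF assms(2-4), folded Y_def]
    unfolding is_weighted_mp_inverse_def einstein_prod_assoc P_def by auto
  have AP: "A \<star>\<^bsub>I\<^esub> P = P \<star>\<^bsub>I\<^esub> A" and XP: "X \<star>\<^bsub>I\<^esub> P = P \<star>\<^bsub>I\<^esub> X"
    using assms(6,7) by (simp_all add: P_def X_def Y_def)
  \<comment> \<open>\<open>P\<close> passes first through \<open>X\<close>, then through
    \<open>A\<close>.\<close>
  have QP: "Q \<star>\<^bsub>I\<^esub> P = P \<star>\<^bsub>I\<^esub> Q"
    unfolding Q_def using AP XP by (metis einstein_prod_assoc)
  have NY: "N \<star>\<^bsub>I\<^esub> Y = ?H B \<star>\<^bsub>I\<^esub> N"
    using assms(5) by (simp add: Y_def conj_transpose_einstein_prod H_N)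
  \<comment> \<open>The product equals \<open>A P X\<close>, and \<open>P\<close> moves left past
    \<open>A\<close>. The first three Penrose equations are all checked through this form.\<close>
  have ABYX: "A \<star>\<^bsub>I\<^esub> B \<star>\<^bsub>I\<^esub> (Y \<star>\<^bsub>I\<^esub> X) = P \<star>\<^bsub>I\<^esub> Q"
    unfolding Q_def using AP P_def by (metis einstein_prod_assoc)
  have "is_weighted_mp_inverse I M N (A \<star>\<^bsub>I\<^esub> B) (Y \<star>\<^bsub>I\<^esub> X)"
    unfolding is_weighted_mp_inverse_def
  proof (intro conjI)
    \<comment> \<open>Moving \<open>P\<close> right past \<open>A\<close> brings it to
      \<open>B\<close>, where \<open>P B = B\<close>; then \<open>Q A = A\<close>.\<close>
    have "Q \<star>\<^bsub>I\<^esub> P \<star>\<^bsub>I\<^esub> (A \<star>\<^bsub>I\<^esub> B) = Q \<star>\<^bsub>I\<^esub> A \<star>\<^bsub>I\<^esub> (P \<star>\<^bsub>I\<^esub> B)"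
      using AP by (metis einstein_prod_assoc)
    also have "\<dots> = A \<star>\<^bsub>I\<^esub> B"
      by (simp add: Q_def X Y einstein_prod_assoc)
    finally show "A \<star>\<^bsub>I\<^esub> B \<star>\<^bsub>I\<^esub> (Y \<star>\<^bsub>I\<^esub> X) \<star>\<^bsub>I\<^esub> (A \<star>\<^bsub>I\<^esub> B) = A \<star>\<^bsub>I\<^esub> B"
      by (simp add: ABYX QP)
    \<comment> \<open>Moving \<open>P\<close> left past \<open>X\<close> brings it to
      \<open>Y\<close>, where \<open>Y P = Y\<close>; then \<open>X Q = X\<close>.\<close>
    have "Y \<star>\<^bsub>I\<^esub> X \<star>\<^bsub>I\<^esub> (P \<star>\<^bsub>I\<^esub> Q) = Y \<star>\<^bsub>I\<^esub> P \<star>\<^bsub>I\<^esub> (X \<star>\<^bsub>I\<^esub> Q)"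
      using XP by (metis einstein_prod_assoc)
    also have "\<dots> = Y \<star>\<^bsub>I\<^esub> X"
      by (simp add: Q_def X Y)
    finally show "Y \<star>\<^bsub>I\<^esub> X \<star>\<^bsub>I\<^esub> (A \<star>\<^bsub>I\<^esub> B) \<star>\<^bsub>I\<^esub> (Y \<star>\<^bsub>I\<^esub> X) = Y \<star>\<^bsub>I\<^esub> X"
      by (simp add: einstein_prod_assoc[of "Y \<star>\<^bsub>I\<^esub> X"] ABYX)
    \<comment> \<open>The transpose reverses the factors \<open>P\<close> and \<open>Q\<close>;
      their commuting restores the order.\<close>
    have "?H (M \<star>\<^bsub>I\<^esub> (P \<star>\<^bsub>I\<^esub> Q)) = M \<star>\<^bsub>I\<^esub> (Q \<star>\<^bsub>I\<^esub> P)"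
      using X(3) Y(3) H_M by (metis conj_transpose_einstein_prod einstein_prod_assoc)
    then show "?H (M \<star>\<^bsub>I\<^esub> (A \<star>\<^bsub>I\<^esub> B) \<star>\<^bsub>I\<^esub> (Y \<star>\<^bsub>I\<^esub> X)) = M \<star>\<^bsub>I\<^esub> (A \<star>\<^bsub>I\<^esub> B) \<star>\<^bsub>I\<^esub> (Y \<star>\<^bsub>I\<^esub> X)"
      by (simp add: einstein_prod_assoc[of M] ABYX QP)
    have "N \<star>\<^bsub>I\<^esub> (Y \<star>\<^bsub>I\<^esub> X) \<star>\<^bsub>I\<^esub> (A \<star>\<^bsub>I\<^esub> B) = ?H B \<star>\<^bsub>I\<^esub> (N \<star>\<^bsub>I\<^esub> (X \<star>\<^bsub>I\<^esub> A)) \<star>\<^bsub>I\<^esub> B"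
      using NY by (metis einstein_prod_assoc)
    moreover have "?H (?H B \<star>\<^bsub>I\<^esub> (N \<star>\<^bsub>I\<^esub> (X \<star>\<^bsub>I\<^esub> A)) \<star>\<^bsub>I\<^esub> B) = ?H B \<star>\<^bsub>I\<^esub> (N \<star>\<^bsub>I\<^esub> (X \<star>\<^bsub>I\<^esub> A)) \<star>\<^bsub>I\<^esub> B"
      using assms(2) X(4)
      by (metis conj_transpose_conj_transpose conj_transpose_einstein_prod einstein_prod_assoc)
    ultimately show "?H (N \<star>\<^bsub>I\<^esub> (Y \<star>\<^bsub>I\<^esub> X) \<star>\<^bsub>I\<^esub> (A \<star>\<^bsub>I\<^esub> B)) = N \<star>\<^bsub>I\<^esub> (Y \<star>\<^bsub>I\<^esub> X) \<star>\<^bsub>I\<^esub> (A \<star>\<^bsub>I\<^esub> B)"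
      by simp
  qed simp
  then show ?thesis
    using weighted_mp_inverse_eqI[OF assms(3,4)] by (simp add: X_def Y_def)
qed

end
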